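(* Let $q\in(0,1)$, $\omega\ge0$, let $I$ be a real interval containing $\omega_0=\frac{\omega}{1-q}$, let $a,b\in I$ with $a<b$, and let $\alpha,\beta\in\mathbb R$. Let $L(t,u,v)$ be a real function on $I\times\mathbb R^2$. Consider the problem of extremizing (minimizing or maximizing) $$\mathcal L[y]=\int_a^bL\left(t,y^\sigma(t),\tilde D_{q,\omega}[y](t)\right)\tilde d_{q,\omega}t$$ over all $y\in\mathcal Y^1([a,b]_{q,\omega},\mathbb R)$ with $y(a)=\alpha$ and $y(b)=\beta$ (such $y$ are called admissible). Assume: (i) $(u,v)\mapsto L(t,u,v)$ is a $C^1(\mathbb R^2,\mathbb R)$ function for every $t\in I$; (ii) $t\mapsto L(t,y^\sigma(t),\tilde D_{q,\omega}[y](t))$ is continuous at $\omega_0$ for every admissible $y$; (iii) for every admissible $y$ and $i=0,1$, the function $t\mapsto\partial_{i+2}L(t,y^\sigma(t),\tilde D_{q,\omega}[y](t))$ belongs to $\mathcal Y^1([a,b]_{q,\omega},\mathbb R)$; (iv) for every admissible $y$ and every admissible variation $\eta$, putting $g(t,\epsilon)=L(t,y^\sigma(t)+\epsilon\eta^\sigma(t),\tilde D_{q,\omega}[y](t)+\epsilon\tilde D_{q,\omega}[\eta](t))$, the function $g(t,\cdot)$ is differentiable at $0$ uniformly in $[a,b]_{q,\omega}$; for $\xi\in\{a,b\}$ the integrals $\int_{\omega_0}^{\xi}g(t,\epsilon)\,\tilde d_{q,\omega}t$ exist for all $\epsilon$ near $0$; and the integrals $\int_{\omega_0}^a\partial_2g(t,0)\,\tilde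 d_{q,\omega}t$ and $\int_{\omega_0}^b\partial_2g(t,0)\,\tilde d_{q,\omega}t$ exist. If $y_*\in\mathcal Y^1([a,b]_{q,\omega},\mathbb R)$ is a local extremizer (local minimizer or local maximizer) of this problem, then $y=y_*$ satisfies the Hahn symmetric Euler–Lagrange equation $$\partial_2L\left(t,y^\sigma(t),\tilde D_{q,\omega}[y](t)\right)=\tilde D_{q,\omega}\left[\tau\mapsto\partial_3L\left(\sigma(\tau),y^{\sigma^2}(\tau),(\tilde D_{q,\omega}[y])^\sigma(\tau)\right)\right](t)$$ for all $t\in[a,b]_{q,\omega}$.
   Context: Notation: $\sigma(t)=qt+\omega$, $\sigma^{-1}(t)=q^{-1}(t-\omega)$, $\sigma^k$ the $k$-fold composition, $f^{\sigma^k}=f\circ\sigma^k$. $\partial_jL$ is the partial derivative of $L$ with respect to its $j$th argument. Hahn symmetric derivative: for $f:I\to\mathbb R$ and $t\in(qI+\omega)\setminus\{\omega_0\}$, $\tilde D_{q,\omega}[f](t)=\frac{f(qt+\omega)-f(q^{-1}(t-\omega))}{(q-q^{-1})t+(1+q^{-1})\omega}=\frac{f(\sigma(t))-f(\sigma^{-1}(t))}{\sigma(t)-\sigma^{-1}(t)}$, and $\tilde D_{q,\omega}[f](\omega_0)=f'(\omega_0)$ provided $f$ is differentiable at $\omega_0$. Integral: $\int_a^bf\,\tilde d_{q,\omega}t=\int_{\omega_0}^bf\,\tilde d_{q,\omega}t-\int_{\omega_0}^af\,\tilde d_{q,\omega}t$, where $\int_{\omega_0}^xf(t)\,\tilde d_{q,\omega}t=(\sigma^{-1}(x)-\sigma(x))\sum_{n=0}^{\infty}q^{2n+1}f(\sigma^{2n+1}(x))$;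 it exists when the series converge. Set: $[a,b]_{q,\omega}=\{\sigma^{2n+1}(a):n\in\mathbb N_0\}\cup\{\sigma^{2n+1}(b):n\in\mathbb N_0\}\cup\{\omega_0\}$. Space: $\mathcal Y^1([a,b]_{q,\omega},\mathbb R)$ is the set of $y:I\to\mathbb R$ such that $y$ and $\tilde D_{q,\omega}[y]$ are bounded on $[a,b]_{q,\omega}$ and continuous at $\omega_0$, with norm $\|y\|_1=\sup_{t\in[a,b]_{q,\omega}}|y(t)|+\sup_{t\in[a,b]_{q,\omega}}|\tilde D_{q,\omega}[y](t)|$. An admissible variation is $\eta\in\mathcal Y^1([a,b]_{q,\omega},\mathbb R)$ with $\eta(a)=\eta(b)=0$. An admissible $y_*$ is a local minimizer (resp. maximizer) if there is $\delta>0$ with $\mathcal L[y_*]\le\mathcal L[y]$ (resp. $\ge$) for all admissible $y$ with $\|y_*-y\|_1<\delta$. $g(t,\cdot)$ is differentiable at $\theta_0$ uniformly in a set $S$ if for every $\varepsilon>0$ there is $\delta>0$ such that $0<|\theta-\theta_0|<\delta$ implies $\left|\frac{g(t,\theta)-g(t,\theta_0)}{\theta-\theta_0}-\partial_2g(t,\theta_0)\right|<\varepsilon$ for all $t\in S$, where $\partial_2g=\partial g/\partial\theta$.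
   Formalization: Adds the hypothesis that neither endpoint is σ^{2k} of the other, k≥1. Without it the claim fails: for q=1/2, ω=0, a=-4, b=-1, L=u, the functional is constant on admissible y, so each is an extremizer, yet the equation reads 1=0. *)

theory Defs
  imports "HOL-Analysis.Analysis"
begin

text \<open>
  Functions \<open>I \<rightarrow> \<real>\<close> are represented by total functions on the reals together with the
  interval \<open>I\<close>; values outside \<open>I\<close> are irrelevant. Throughout, \<open>0 < q < 1\<close> is intended, so that
  the shift \<open>t \<mapsto> q t + \<omega>\<close> contracts towards its fixed point \<open>\<omega> / (1 - q)\<close>.
\<close>

definition hahn_shift :: "real \<Rightarrow> real \<Rightarrow> real \<Rightarrow> real" where
  "hahn_shift q \<omega> t = q * t + \<omega>"

definition hahn_shift_inv :: "real \<Rightarrow> real \<Rightarrow> real \<Rightarrow> real" where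
  "hahn_shift_inv q \<omega> t = (t - \<omega>) / q"

definition hahn_fixpoint :: "real \<Rightarrow> real \<Rightarrow> real" where
  "hahn_fixpoint q \<omega> = \<omega> / (1 - q)"

text \<open>
  At the fixed point, which may be an endpoint of \<open>I\<close>, the Hahn symmetric derivative is the
  derivative of \<open>f\<close> as a function on \<open>I\<close>; it is meaningful only if that derivative exists.
  At other points it is meaningful on the image of \<open>I\<close> under the shift.
\<close>

definition hahn_deriv :: "real set \<Rightarrow> real \<Rightarrow> real \<Rightarrow> (real \<Rightarrow> real) \<Rightarrow> real \<Rightarrow> real" where
  "hahn_deriv I q \<omega> f t =
     (if t = hahn_fixpoint q \<omega>
      then (THE D. (f has_real_derivative D) (at t within I))
      else (f (hahn_shift q \<omega> t) - f (hahn_shift_inv q \<omega> t)) /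
           (hahn_shift q \<omega> t - hahn_shift_inv q \<omega> t))"

definition hahn_integrable_to :: "real \<Rightarrow> real \<Rightarrow> real \<Rightarrow> (real \<Rightarrow> real) \<Rightarrow> bool" where
  "hahn_integrable_to q \<omega> x f \<longleftrightarrow>
     summable (\<lambda>n. q ^ (2 * n + 1) * f ((hahn_shift q \<omega> ^^ (2 * n + 1)) x))"

definition hahn_integral_to :: "real \<Rightarrow> real \<Rightarrow> real \<Rightarrow> (real \<Rightarrow> real) \<Rightarrow> real" where
  "hahn_integral_to q \<omega> x f =
     (hahn_shift_inv q \<omega> x - hahn_shift q \<omega> x) *
     (\<Sum>n. q ^ (2 * n + 1) * f ((hahn_shift q \<omega> ^^ (2 * n + 1)) x))"

definition hahn_integral :: "real \<Rightarrow> real \<Rightarrow> real \<Rightarrow> real \<Rightarrow> (real \<Rightarrow> real) \<Rightarrow> real" where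
  "hahn_integral q \<omega> a b f = hahn_integral_to q \<omega> b f - hahn_integral_to q \<omega> a f"

definition hahn_set :: "real \<Rightarrow> real \<Rightarrow> real \<Rightarrow> real \<Rightarrow> real set" where
  "hahn_set q \<omega> a b =
     {(hahn_shift q \<omega> ^^ (2 * n + 1)) a | n. True} \<union>
     {(hahn_shift q \<omega> ^^ (2 * n + 1)) b | n. True} \<union>
     {hahn_fixpoint q \<omega>}"

text \<open>
  Differentiability at the fixed point is what makes the Hahn symmetric derivative defined there.
  Continuity of that derivative is relative to its domain, the shifted interval, which is a
  neighbourhood of the fixed point in \<open>I\<close>.
\<close>

definition Y1 :: "real set \<Rightarrow> real \<Rightarrow> real \<Rightarrow> real \<Rightarrow> real \<Rightarrow> (real \<Rightarrow> real) set" where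
  "Y1 I q \<omega> a b =
     {y. bounded (y ` hahn_set q \<omega> a b) \<and>
         bounded (hahn_deriv I q \<omega> y ` hahn_set q \<omega> a b) \<and>
         continuous (at (hahn_fixpoint q \<omega>) within I) y \<and>
         y differentiable (at (hahn_fixpoint q \<omega>) within I) \<and>
         continuous (at (hahn_fixpoint q \<omega>) within hahn_shift q \<omega> ` I) (hahn_deriv I q \<omega> y)}"

definition Y1_norm :: "real set \<Rightarrow> real \<Rightarrow> real \<Rightarrow> real \<Rightarrow> real \<Rightarrow> (real \<Rightarrow> real) \<Rightarrow> real" where
  "Y1_norm I q \<omega> a b y =
     (SUP t\<in>hahn_set q \<omega> a b. \<bar>y t\<bar>) + (SUP t\<in>hahn_set q \<omega> a b. \<bar>hahn_deriv I q \<omega> y t\<bar>)"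

definition admissible ::
  "real set \<Rightarrow> real \<Rightarrow> real \<Rightarrow> real \<Rightarrow> real \<Rightarrow> real \<Rightarrow> real \<Rightarrow> (real \<Rightarrow> real) set" where
  "admissible I q \<omega> a b \<alpha> \<beta> = {y \<in> Y1 I q \<omega> a b. y a = \<alpha> \<and> y b = \<beta>}"

definition admissible_variation ::
  "real set \<Rightarrow> real \<Rightarrow> real \<Rightarrow> real \<Rightarrow> real \<Rightarrow> (real \<Rightarrow> real) set" where
  "admissible_variation I q \<omega> a b = {\<eta> \<in> Y1 I q \<omega> a b. \<eta> a = 0 \<and> \<eta> b = 0}"

definition along ::
  "real set \<Rightarrow> real \<Rightarrow> real \<Rightarrow> (real \<Rightarrow> real \<Rightarrow> real \<Rightarrow> real) \<Rightarrow> (real \<Rightarrow> real) \<Rightarrow> real \<Rightarrow> real" where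
  "along I q \<omega> F y t = F t (y (hahn_shift q \<omega> t)) (hahn_deriv I q \<omega> y t)"

definition hahn_functional ::
  "real set \<Rightarrow> real \<Rightarrow> real \<Rightarrow> real \<Rightarrow> real \<Rightarrow> (real \<Rightarrow> real \<Rightarrow> real \<Rightarrow> real) \<Rightarrow> (real \<Rightarrow> real) \<Rightarrow> real" where
  "hahn_functional I q \<omega> a b L y = hahn_integral q \<omega> a b (along I q \<omega> L y)"

definition local_minimizer ::
  "real set \<Rightarrow> real \<Rightarrow> real \<Rightarrow> real \<Rightarrow> real \<Rightarrow> real \<Rightarrow> real \<Rightarrow>
   (real \<Rightarrow> real \<Rightarrow> real \<Rightarrow> real) \<Rightarrow> (real \<Rightarrow> real) \<Rightarrow> bool" where
  "local_minimizer I q \<omega> a b \<alpha> \<beta> L ys \<longleftrightarrow>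
     ys \<in> admissible I q \<omega> a b \<alpha> \<beta> \<and>
     (\<exists>\<delta>>0. \<forall>y\<in>admissible I q \<omega> a b \<alpha> \<beta>.
        Y1_norm I q \<omega> a b (\<lambda>t. ys t - y t) < \<delta> \<longrightarrow>
        hahn_functional I q \<omega> a b L ys \<le> hahn_functional I q \<omega> a b L y)"

definition local_maximizer ::
  "real set \<Rightarrow> real \<Rightarrow> real \<Rightarrow> real \<Rightarrow> real \<Rightarrow> real \<Rightarrow> real \<Rightarrow>
   (real \<Rightarrow> real \<Rightarrow> real \<Rightarrow> real) \<Rightarrow> (real \<Rightarrow> real) \<Rightarrow> bool" where
  "local_maximizer I q \<omega> a b \<alpha> \<beta> L ys \<longleftrightarrow>
     ys \<in> admissible I q \<omega> a b \<alpha> \<beta> \<and>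
     (\<exists>\<delta>>0. \<forall>y\<in>admissible I q \<omega> a b \<alpha> \<beta>.
        Y1_norm I q \<omega> a b (\<lambda>t. ys t - y t) < \<delta> \<longrightarrow>
        hahn_functional I q \<omega> a b L ys \<ge> hahn_functional I q \<omega> a b L y)"

definition C1 :: "('a::real_normed_vector \<Rightarrow> 'b::real_normed_vector) \<Rightarrow> bool" where
  "C1 f \<longleftrightarrow>
     (\<exists>f' :: 'a \<Rightarrow> 'a \<Rightarrow>\<^sub>L 'b.
        (\<forall>x. (f has_derivative blinfun_apply (f' x)) (at x)) \<and> continuous_on UNIV f')"

definition partial2 :: "(real \<Rightarrow> real \<Rightarrow> real \<Rightarrow> real) \<Rightarrow> real \<Rightarrow> real \<Rightarrow> real \<Rightarrow> real" where
  "partial2 L t u v = deriv (\<lambda>x. L t x v) u"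

definition partial3 :: "(real \<Rightarrow> real \<Rightarrow> real \<Rightarrow> real) \<Rightarrow> real \<Rightarrow> real \<Rightarrow> real \<Rightarrow> real" where
  "partial3 L t u v = deriv (\<lambda>x. L t u x) v"

definition varied ::
  "real set \<Rightarrow> real \<Rightarrow> real \<Rightarrow> (real \<Rightarrow> real \<Rightarrow> real \<Rightarrow> real) \<Rightarrow> (real \<Rightarrow> real) \<Rightarrow> (real \<Rightarrow> real) \<Rightarrow>
   real \<Rightarrow> real \<Rightarrow> real" where
  "varied I q \<omega> L y \<eta> t \<epsilon> =
     L t (y (hahn_shift q \<omega> t) + \<epsilon> * \<eta> (hahn_shift q \<omega> t))
         (hahn_deriv I q \<omega> y t + \<epsilon> * hahn_deriv I q \<omega> \<eta> t)"

text \<open>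
  The inequality forces every \<open>g t\<close> with \<open>t \<in> S\<close> to be differentiable at \<open>\<theta>\<^sub>0\<close>, so \<open>deriv\<close> is
  meaningful here.
\<close>

definition uniformly_differentiable_at :: "(real \<Rightarrow> real \<Rightarrow> real) \<Rightarrow> real \<Rightarrow> real set \<Rightarrow> bool" where
  "uniformly_differentiable_at g \<theta>\<^sub>0 S \<longleftrightarrow>
     (\<forall>\<epsilon>>0. \<exists>\<delta>>0. \<forall>\<theta>. 0 < \<bar>\<theta> - \<theta>\<^sub>0\<bar> \<and> \<bar>\<theta> - \<theta>\<^sub>0\<bar> < \<delta> \<longrightarrow>
        (\<forall>t\<in>S. \<bar>(g t \<theta> - g t \<theta>\<^sub>0) / (\<theta> - \<theta>\<^sub>0) - deriv (g t) \<theta>\<^sub>0\<bar> < \<epsilon>))"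

text \<open>
  If one endpoint is a proper even iterate of the other, say \<open>b = \<sigma>\<^sup>2\<^sup>k a\<close> with \<open>k \<ge> 1\<close>, the two
  series in the integral over \<open>[a, b]\<close> cancel except for the \<open>k\<close> summands at \<open>\<sigma>\<^sup>2\<^sup>n\<^sup>+\<^sup>1 a\<close>, \<open>n < k\<close>.
  The functional then does not see \<open>y\<close> at the later iterates and the Euler-Lagrange equation can
  fail there: for \<open>b = \<sigma>\<^sup>2 a\<close> and \<open>L t u v = u\<close> the functional is constant on admissible functions,
  while the equation reads \<open>1 = 0\<close>. This predicate excludes exactly that situation; it always
  holds if \<open>a \<le> \<omega> / (1 - q) \<le> b\<close> and \<open>a < b\<close>.
\<close>

definition endpoints_independent :: "real \<Rightarrow> real \<Rightarrow> real \<Rightarrow> real \<Rightarrow> bool" where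
  "endpoints_independent q \<omega> a b \<longleftrightarrow>
     (\<forall>k\<ge>1. (hahn_shift q \<omega> ^^ (2 * k)) a \<noteq> b \<and> (hahn_shift q \<omega> ^^ (2 * k)) b \<noteq> a)"

end

theory Submission
  imports Defs
begin

text \<open>
  The functional sees \<open>y\<close> only at the even iterates \<open>\<sigma>\<^sup>2\<^sup>n\<close> of the endpoints, so no fundamental
  lemma or integration by parts is needed: one varies \<open>y\<close> at the single point
  \<open>p = \<sigma>\<^sup>2\<^sup>n\<^sup>+\<^sup>2 x\<close>, where \<open>x \<noteq> \<omega>\<^sub>0\<close> is an endpoint. Independence of the endpoints makes
  this an admissible variation that changes exactly two summands, those at \<open>t = \<sigma>\<^sup>2\<^sup>n\<^sup>+\<^sup>1 x\<close> and
  at \<open>\<sigma>\<^sup>2 t\<close>. Stationarity of these two summands is the Euler-Lagrange equation at \<open>t\<close>.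
  The equation at \<open>\<omega>\<^sub>0\<close> follows by letting \<open>n\<close> tend to infinity.
\<close>

section \<open>Directional derivatives and differences of series\<close>

text \<open>The chain rule expresses the slope through the total derivative applied to
  \<open>(r, s)\<close>. Taking the directions \<open>(1, 0)\<close> and \<open>(0, 1)\<close>
  identifies its components as the partial derivatives given by \<open>deriv\<close>, and linearity
  combines them.\<close>

lemma C1_line_derivative:
  fixes G :: "real \<Rightarrow> real \<Rightarrow> real"
  assumes "C1 (\<lambda>(u, v). G u v)"
  shows "((\<lambda>e. G (u + e * r) (v + e * s)) has_real_derivative
           deriv (\<lambda>x. G x v) u * r + deriv (G u) v * s) (at 0)"
proof -
  obtain F where F: "\<And>z. ((\<lambda>(u, v). G u v) has_derivative blinfun_apply (F z)) (at z)"
    using assms unfolding C1_def by blast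
  have line: "((\<lambda>e. G (u + e * r') (v + e * s')) has_real_derivative
                blinfun_apply (F (u, v)) (r', s')) (at 0)" for r' s'
  proof -
    have "((\<lambda>e. (u + e * r', v + e * s')) has_derivative (\<lambda>h. (h * r', h * s'))) (at 0)"
      by (auto intro!: derivative_eq_intros)
    from has_derivative_compose[OF this, of "\<lambda>(u, v). G u v"] F[of "(u, v)"]
    have "((\<lambda>e. G (u + e * r') (v + e * s')) has_derivative
            (\<lambda>h. blinfun_apply (F (u, v)) (h * r', h * s'))) (at 0)"
      by simp
    moreover have "blinfun_apply (F (u, v)) (h * r', h * s')
        = blinfun_apply (F (u, v)) (r', s') * h" for h
      using blinfun.scaleR_right[of "F (u, v)" h "(r', s')"] by simp
    ultimately show ?thesis
      by (simp add: has_field_derivative_def)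
  qed
  have "((\<lambda>x. G x v) has_real_derivative blinfun_apply (F (u, v)) (1, 0)) (at u)"
    using line[of 1 0] DERIV_shift[of "\<lambda>x. G x v" _ 0 u] by (simp add: add.commute)
  moreover have "(G u has_real_derivative blinfun_apply (F (u, v)) (0, 1)) (at v)"
    using line[of 0 1] DERIV_shift[of "G u" _ 0 v] by (simp add: add.commute)
  moreover have "blinfun_apply (F (u, v)) (r, s)
      = blinfun_apply (F (u, v)) (1, 0) * r + blinfun_apply (F (u, v)) (0, 1) * s"
  proof -
    have "(r, s) = r *\<^sub>R (1, 0) + s *\<^sub>R (0, 1)" by simp
    then show ?thesis
      by (simp only: blinfun.add_right blinfun.scaleR_right) simp
  qed
  ultimately show ?thesis
    using line[of r s] by (simp add: DERIV_imp_deriv)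
qed

text \<open>A one-point variation alters two consecutive summands of the integral's series, so the
  difference of two convergent series collapses to a finite sum.\<close>

lemma suminf_diff_two_terms:
  fixes f g :: "nat \<Rightarrow> real"
  assumes "summable f" "summable g" "\<And>m. m \<noteq> n \<Longrightarrow> m \<noteq> Suc n \<Longrightarrow> f m = g m"
  shows "suminf f - suminf g = (f n - g n) + (f (Suc n) - g (Suc n))"
proof -
  have "suminf f - suminf g = (\<Sum>m. f m - g m)"
    using assms suminf_diff by blast
  also have "\<dots> = (\<Sum>m\<in>{n, Suc n}. f m - g m)"
    using assms(3) by (intro suminf_finite) auto
  finally show ?thesis by simp
qed

section \<open>Geometry of the Hahn shift and its iterates\<close>

text \<open>The limit point assumption makes derivatives at the fixed point within \<open>I\<close>
  unique, so that the description operator in \<open>hahn_deriv\<close> returns the actual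
  derivative whenever one exists.\<close>

locale hahn_calculus =
  fixes I :: "real set" and q \<omega> :: real
  assumes q_pos: "0 < q" and q_less_1: "q < 1"
    and interval: "is_interval I"
    and fixpoint_in: "hahn_fixpoint q \<omega> \<in> I"
    and islimpt: "hahn_fixpoint q \<omega> islimpt I"
begin

abbreviation \<sigma> where "\<sigma> \<equiv> hahn_shift q \<omega>"
abbreviation \<sigma>inv where "\<sigma>inv \<equiv> hahn_shift_inv q \<omega>"
abbreviation fp where "fp \<equiv> hahn_fixpoint q \<omega>"
abbreviation D where "D \<equiv> hahn_deriv I q \<omega>"

lemma fixpoint_eq: "fp * (1 - q) = \<omega>"
  using q_less_1 by (simp add: hahn_fixpoint_def)

text \<open>Centred at the fixed point, the shift is multiplication by \<open>q\<close>; this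
  reduces statements about iterates to statements about powers of \<open>q\<close>.\<close>

lemma shift_eq: "\<sigma> t = fp + q * (t - fp)"
  using fixpoint_eq by (simp add: hahn_shift_def algebra_simps)

lemma shift_inv_shift [simp]: "\<sigma>inv (\<sigma> t) = t"
  using q_pos by (simp add: hahn_shift_def hahn_shift_inv_def)

lemma shift_shift_inv [simp]: "\<sigma> (\<sigma>inv t) = t"
  using q_pos by (simp add: hahn_shift_def hahn_shift_inv_def)

lemma shift_inv_eq: "\<sigma>inv t = fp + (t - fp) / q"
proof -
  have "q * (\<sigma>inv t - fp) = t - fp"
    using shift_eq[of "\<sigma>inv t"] by simp
  then show ?thesis
    using q_pos by (simp add: field_simps)
qed

lemma iterate_eq: "(\<sigma> ^^ k) t = fp + q ^ k * (t - fp)"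
  by (induction k) (simp_all add: shift_eq)

lemma iterate_fp [simp]: "(\<sigma> ^^ k) fp = fp"
  by (simp add: iterate_eq)

lemma shift_fp [simp]: "\<sigma> fp = fp"
  by (simp add: shift_eq)

lemma iterate_eq_fp_iff [simp]: "(\<sigma> ^^ k) t = fp \<longleftrightarrow> t = fp"
  using q_pos by (simp add: iterate_eq)

lemma iterate_inject [simp]: "(\<sigma> ^^ k) s = (\<sigma> ^^ k) t \<longleftrightarrow> s = t"
  using q_pos by (simp add: iterate_eq)

lemma iterate_index_inject:
  assumes "x \<noteq> fp"
  shows "(\<sigma> ^^ j) x = (\<sigma> ^^ k) x \<longleftrightarrow> j = k"
proof -
  have "q ^ j = q ^ k \<longleftrightarrow> j = k"
    using q_pos q_less_1 power_strict_decreasing[of j k q] power_strict_decreasing[of k j q]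
    by (metis linorder_neqE_nat less_irrefl)
  then show ?thesis using assms by (simp add: iterate_eq)
qed

lemma iterate_tendsto: "(\<lambda>k. (\<sigma> ^^ k) x) \<longlonglongrightarrow> fp"
proof -
  have "(\<lambda>k. fp + q ^ k * (x - fp)) \<longlonglongrightarrow> fp + 0 * (x - fp)"
    using q_pos q_less_1 by (intro tendsto_intros LIMSEQ_realpow_zero) auto
  then show ?thesis by (simp add: iterate_eq)
qed

lemma iterate_in:
  assumes "x \<in> I"
  shows "(\<sigma> ^^ k) x \<in> I"
proof -
  have "convex I" using interval by (simp add: is_interval_convex_1)
  moreover have "(\<sigma> ^^ k) x = (1 - q ^ k) *\<^sub>R fp + q ^ k *\<^sub>R x"
    by (simp add: iterate_eq algebra_simps)
  ultimately show ?thesis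
    using assms fixpoint_in q_pos q_less_1
    by (simp add: convexD power_le_one del: real_scaleR_def)
qed

lemma shift_diff_eq: "\<sigma> t - \<sigma>inv t = (q - 1 / q) * (t - fp)"
  unfolding shift_eq shift_inv_eq by (simp add: left_diff_distrib)

lemma shift_diff_eq_0_iff: "\<sigma> t - \<sigma>inv t = 0 \<longleftrightarrow> t = fp"
proof -
  have "q * q < 1 * 1"
    using q_pos q_less_1 by (intro mult_strict_mono) auto
  then have "q - 1 / q \<noteq> 0"
    using q_pos by (auto simp: field_simps)
  then show ?thesis by (simp add: shift_diff_eq)
qed

section \<open>The Hahn symmetric derivative\<close>

lemma hahn_deriv_off_fp:
  "t \<noteq> fp \<Longrightarrow> D f t = (f (\<sigma> t) - f (\<sigma>inv t)) / (\<sigma> t - \<sigma>inv t)"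
  by (simp add: hahn_deriv_def)

lemma hahn_deriv_at_fp:
  assumes "(f has_real_derivative d) (at fp within I)"
  shows "D f fp = d"
proof -
  have "at fp within I \<noteq> bot"
    using islimpt by (simp add: trivial_limit_within)
  then have "(THE d. (f has_real_derivative d) (at fp within I)) = d"
    using assms tendsto_unique unfolding has_field_derivative_iff by blast
  then show ?thesis by (simp add: hahn_deriv_def)
qed

lemma has_hahn_deriv_at_fp:
  assumes "f differentiable (at fp within I)"
  shows "(f has_real_derivative D f fp) (at fp within I)"
  using assms hahn_deriv_at_fp real_differentiable_def by metis

lemma hahn_deriv_add_scaled:
  assumes "f differentiable (at fp within I)" "g differentiable (at fp within I)"
  shows "D (\<lambda>t. f t + e * g t) t = D f t + e * D g t"
proof (cases "t = fp")
  case True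
  have "((\<lambda>t. f t + e * g t) has_real_derivative D f fp + e * D g fp) (at fp within I)"
    by (intro DERIV_add DERIV_cmult has_hahn_deriv_at_fp assms)
  then show ?thesis using True hahn_deriv_at_fp by blast
next
  case False
  then show ?thesis
    by (simp add: hahn_deriv_off_fp add_divide_distrib[symmetric] right_diff_distrib)
qed

text \<open>The points entering the Hahn quotient lie at offsets \<open>w\<close> and
  \<open>q\<^sup>2 * w\<close> from the fixed point. The quotient is therefore a combination of two
  ordinary difference quotients based at \<open>fp\<close>, with constant weights of sum 1, and
  inherits their limit.\<close>

lemma hahn_deriv_iterate_tendsto:
  assumes f: "f differentiable (at fp within I)" and x: "x \<in> I" "x \<noteq> fp"
  shows "(\<lambda>n. D f ((\<sigma> ^^ (2 * n + 1)) x)) \<longlonglongrightarrow> D f fp"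
proof -
  define r where "r k = (f ((\<sigma> ^^ k) x) - f fp) / ((\<sigma> ^^ k) x - fp)" for k
  have "((\<lambda>t. (f t - f fp) / (t - fp)) \<longlongrightarrow> D f fp) (at fp within I)"
    using has_hahn_deriv_at_fp[OF f] by (simp add: has_field_derivative_iff)
  moreover have "filterlim (\<lambda>k. (\<sigma> ^^ k) x) (at fp within I) sequentially"
    using iterate_tendsto iterate_in x by (simp add: filterlim_at)
  ultimately have r: "r \<longlonglongrightarrow> D f fp"
    unfolding r_def by (rule filterlim_compose)
  have q2: "q\<^sup>2 - 1 \<noteq> 0"
    using q_pos q_less_1 power_strict_mono[of q 1 2] by simp
  have eq: "D f ((\<sigma> ^^ Suc k) x) = (q\<^sup>2 * r (k + 2) - r k) / (q\<^sup>2 - 1)" for k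
  proof -
    define w where "w = q ^ k * (x - fp)"
    have w: "w \<noteq> 0" using x q_pos by (simp add: w_def)
    have pts: "(\<sigma> ^^ k) x = fp + w" "\<sigma> ((\<sigma> ^^ Suc k) x) = fp + q\<^sup>2 * w"
      "(\<sigma> ^^ (k + 2)) x = fp + q\<^sup>2 * w"
      by (simp_all add: w_def iterate_eq shift_eq power2_eq_square)
    have inv: "\<sigma>inv ((\<sigma> ^^ Suc k) x) = fp + w" using pts(1) by simp
    have "D f ((\<sigma> ^^ Suc k) x) = (f (fp + q\<^sup>2 * w) - f (fp + w)) / (q\<^sup>2 * w - w)"
      using x by (subst hahn_deriv_off_fp) (simp_all only: pts(2) inv iterate_eq_fp_iff, simp_all)
    also have "\<dots> = ((f (fp + q\<^sup>2 * w) - f fp) / w - (f (fp + w) - f fp) / w) / (q\<^sup>2 - 1)"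
      using w q2 by (simp add: field_simps)
    also have "\<dots> = (q\<^sup>2 * r (k + 2) - r k) / (q\<^sup>2 - 1)"
      using q_pos unfolding r_def pts by simp
    finally show ?thesis .
  qed
  have "(\<lambda>k. (q\<^sup>2 * r (k + 2) - r k) / (q\<^sup>2 - 1))
      \<longlonglongrightarrow> (q\<^sup>2 * D f fp - D f fp) / (q\<^sup>2 - 1)"
    using q2 by (intro tendsto_intros r LIMSEQ_ignore_initial_segment)
  moreover have "(q\<^sup>2 * D f fp - D f fp) / (q\<^sup>2 - 1) = D f fp"
    using q2 by (simp add: field_simps)
  ultimately have "(\<lambda>k. D f ((\<sigma> ^^ Suc k) x)) \<longlonglongrightarrow> D f fp"
    by (simp only: eq)
  \<comment> \<open>With \<open>k = 2 * n\<close>, the index \<open>Suc k\<close> runs through the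
    odd iterates.\<close>
  from LIMSEQ_subseq_LIMSEQ[OF this, of "\<lambda>n. 2 * n"] show ?thesis
    by (simp add: strict_mono_def o_def)
qed

section \<open>Variations in the space \<open>Y1\<close>\<close>

lemma Y1_add_scaled:
  assumes "f \<in> Y1 I q \<omega> a b" "g \<in> Y1 I q \<omega> a b"
  shows "(\<lambda>t. f t + e * g t) \<in> Y1 I q \<omega> a b"
proof -
  have diff: "f differentiable (at fp within I)" "g differentiable (at fp within I)"
    using assms by (auto simp: Y1_def)
  have deriv: "D (\<lambda>t. f t + e * g t) = (\<lambda>t. D f t + e * D g t)"
    using hahn_deriv_add_scaled[OF diff] by blast
  have bdd: "bounded ((\<lambda>t. u t + e * v t) ` S)"
    if "bounded (u ` S)" "bounded (v ` S)" for u v :: "real \<Rightarrow> real" and S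
    using bounded_plus_comp[OF that(1) bounded_scaleR_comp[OF that(2), of e]] by simp
  show ?thesis
    using assms unfolding Y1_def mem_Collect_eq deriv
    by (auto intro!: bdd continuous_intros differentiable_add differentiable_mult)
qed

lemma single_point_derivative:
  assumes "p \<noteq> fp"
  shows "(indicator {p} has_real_derivative 0) (at fp within I)"
proof -
  have "\<forall>\<^sub>F t in nhds fp. indicator {p} t = (0 :: real)"
    using t1_space_nhds[OF assms[symmetric]] by (auto elim!: eventually_mono)
  then have "(indicator {p} has_real_derivative 0) (at fp)"
    by (rule DERIV_cong_ev[OF refl _ refl, THEN iffD2]) (rule DERIV_const)
  then show ?thesis
    by (rule has_field_derivative_at_within)
qed

lemma single_point_hahn_deriv_fp:
  "p \<noteq> fp \<Longrightarrow> D (indicator {p}) fp = 0"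
  using single_point_derivative hahn_deriv_at_fp by blast

lemma single_point_hahn_deriv_eq_0:
  assumes "p \<noteq> fp" "\<sigma> t \<noteq> p" "\<sigma>inv t \<noteq> p"
  shows "D (indicator {p}) t = 0"
  using assms by (cases "t = fp") (simp_all add: single_point_hahn_deriv_fp hahn_deriv_off_fp)

text \<open>The Hahn derivative of the indicator can be nonzero only at \<open>\<sigma>inv p\<close>
  and \<open>\<sigma> p\<close>. Hence it takes finitely many values, and since neither point is
  \<open>fp\<close> it vanishes near \<open>fp\<close>.\<close>

lemma single_point_in_Y1:
  assumes p: "p \<noteq> fp"
  shows "indicator {p} \<in> Y1 I q \<omega> a b"
proof -
  have bdd: "bounded ((indicator {p} :: real \<Rightarrow> real) ` S)" for S
    by (rule finite_imp_bounded, rule finite_subset[of _ "{0, 1}"]) (auto simp: indicator_def)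
  have zero: "D (indicator {p}) t = 0" if "t \<noteq> \<sigma>inv p" "t \<noteq> \<sigma> p" for t
    using that p by (intro single_point_hahn_deriv_eq_0) auto
  have "D (indicator {p}) ` S \<subseteq> {0, D (indicator {p}) (\<sigma>inv p), D (indicator {p}) (\<sigma> p)}" for S
    by (rule image_subsetI) (metis zero insertCI)
  then have bdd': "bounded (D (indicator {p}) ` S)" for S
    by (meson finite.emptyI finite_imp_bounded finite_insert finite_subset)
  have ne: "fp \<noteq> \<sigma>inv p" "fp \<noteq> \<sigma> p"
    using p q_pos by (auto simp: shift_eq shift_inv_eq)
  have "\<forall>\<^sub>F t in nhds fp. t \<noteq> \<sigma>inv p \<and> t \<noteq> \<sigma> p"
    using t1_space_nhds[OF ne(1)] t1_space_nhds[OF ne(2)] by (rule eventually_conj)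
  then have ev: "\<forall>\<^sub>F t in nhds fp. D (indicator {p}) t = 0"
    by (rule eventually_mono) (use zero in auto)
  have "isCont (D (indicator {p})) fp"
    using isCont_cong[OF ev] by simp
  then have "continuous (at fp within \<sigma> ` I) (D (indicator {p}))"
    by (rule continuous_at_imp_continuous_at_within)
  moreover have "(indicator {p} :: real \<Rightarrow> real) differentiable (at fp within I)"
    using single_point_derivative[OF p] real_differentiable_def by blast
  ultimately show ?thesis
    using bdd bdd' by (auto simp: Y1_def intro: differentiable_imp_continuous_within)
qed

text \<open>Here \<open>y\<close> cancels pointwise, leaving a multiple of \<eta> whose norm is at
  most \<open>\<bar>e\<bar> * (A + B)\<close>. Small multiples of a variation thus stay inside the
  ball of a local extremum.\<close>

lemma Y1_norm_scaled_small:
  assumes "\<eta> \<in> Y1 I q \<omega> a b" "\<delta> > 0"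
  obtains d where "d > 0"
    "\<And>e. \<bar>e\<bar> < d \<Longrightarrow> Y1_norm I q \<omega> a b (\<lambda>t. y t - (y t + e * \<eta> t)) < \<delta>"
proof -
  obtain A where A: "A > 0" "\<And>t. t \<in> hahn_set q \<omega> a b \<Longrightarrow> \<bar>\<eta> t\<bar> \<le> A"
    using assms(1) unfolding Y1_def bounded_pos by auto
  obtain B where B: "B > 0" "\<And>t. t \<in> hahn_set q \<omega> a b \<Longrightarrow> \<bar>D \<eta> t\<bar> \<le> B"
    using assms(1) unfolding Y1_def bounded_pos by auto
  have diff: "\<eta> differentiable (at fp within I)"
    using assms(1) by (simp add: Y1_def)
  have "D (\<lambda>t. 0) t = 0" for t
    using hahn_deriv_at_fp[of "\<lambda>t. 0" 0] by (cases "t = fp") (simp_all add: hahn_deriv_off_fp)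
  then have deriv: "D (\<lambda>t. - (e * \<eta> t)) t = - e * D \<eta> t" for e t
    using hahn_deriv_add_scaled[OF _ diff, of "\<lambda>t. 0" "- e" t] by simp
  have ne: "hahn_set q \<omega> a b \<noteq> {}" by (auto simp: hahn_set_def)
  have bound: "Y1_norm I q \<omega> a b (\<lambda>t. y t - (y t + e * \<eta> t)) \<le> \<bar>e\<bar> * (A + B)" for e
    unfolding Y1_norm_def distrib_left using A(2) B(2)
    by (intro add_mono cSUP_least[OF ne]) (simp_all add: deriv abs_mult mult_left_mono)
  show thesis
  proof
    show "\<delta> / (A + B) > 0" using A B assms(2) by simp
    show "Y1_norm I q \<omega> a b (\<lambda>t. y t - (y t + e * \<eta> t)) < \<delta>" if "\<bar>e\<bar> < \<delta> / (A + B)" for e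
      using bound[of e] that A(1) B(1) by (simp add: field_simps)
  qed
qed

section \<open>The equation at one iterate and at the fixed point\<close>

lemma along_add_scaled:
  assumes "y differentiable (at fp within I)" "\<eta> differentiable (at fp within I)"
  shows "along I q \<omega> L (\<lambda>t. y t + e * \<eta> t) t = varied I q \<omega> L y \<eta> t e"
  by (simp add: along_def varied_def hahn_deriv_add_scaled[OF assms])

text \<open>
  The sign \<open>s\<close> lets this lemma serve both endpoints and both kinds of extremum.
\<close>

lemma euler_lagrange_iterate:
  assumes x: "x \<in> I" "x \<noteq> fp"
    and disjoint: "\<And>m. (\<sigma> ^^ (2 * m)) w \<noteq> (\<sigma> ^^ (2 * n + 2)) x"
    and C1: "\<And>t. t \<in> I \<Longrightarrow> C1 (\<lambda>(u, v). L t u v)"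
    and y: "y differentiable (at fp within I)"
    and p: "p = (\<sigma> ^^ (2 * n + 2)) x"
    and integrable: "\<And>\<xi>. \<xi> \<in> {x, w} \<Longrightarrow>
          \<forall>\<^sub>F e in nhds 0. hahn_integrable_to q \<omega> \<xi> (\<lambda>t. varied I q \<omega> L y (indicator {p}) t e)"
    and s: "s \<noteq> 0"
    and extremal: "\<forall>\<^sub>F e in nhds 0.
          s * (hahn_integral_to q \<omega> x (along I q \<omega> L y) - hahn_integral_to q \<omega> w (along I q \<omega> L y))
        \<le> s * (hahn_integral_to q \<omega> x (along I q \<omega> L (\<lambda>t. y t + e * indicator {p} t))
             - hahn_integral_to q \<omega> w (along I q \<omega> L (\<lambda>t. y t + e * indicator {p} t)))"
    and t: "t = (\<sigma> ^^ (2 * n + 1)) x"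
  shows "along I q \<omega> (partial2 L) y t = D (\<lambda>\<tau>. along I q \<omega> (partial3 L) y (\<sigma> \<tau>)) t"
proof -
  define g where "g = varied I q \<omega> L y (indicator {p})"
  define t' where "t' = (\<sigma> ^^ (2 * Suc n + 1)) x"
  define d where "d = \<sigma> t - \<sigma>inv t"
  have pne: "p \<noteq> fp" using x iterate_eq_fp_iff unfolding p by blast
  have tne: "t \<noteq> fp" "t' \<noteq> fp" unfolding t t'_def using x by (simp_all only: iterate_eq_fp_iff, simp_all)
  have tI: "t \<in> I" "t' \<in> I" unfolding t t'_def using x iterate_in by blast+
  have t't: "t' = \<sigma> (\<sigma> t)" by (simp add: t t'_def)
  have d0: "d \<noteq> 0" using tne shift_diff_eq_0_iff by (simp add: d_def)
  \<comment> \<open>Two shifts scale the step width by \<open>q\<^sup>2\<close>; the weights of the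
    two summands have the same ratio, and the factors cancel later.\<close>
  have d': "\<sigma> t' - \<sigma>inv t' = q\<^sup>2 * d"
    unfolding d_def shift_diff_eq t't by (simp add: shift_eq power2_eq_square)

  have at_iterate: "\<sigma> ((\<sigma> ^^ (2 * m + 1)) z) = (\<sigma> ^^ (2 * m + 2)) z"
    "\<sigma>inv ((\<sigma> ^^ (2 * m + 1)) z) = (\<sigma> ^^ (2 * m)) z" for m z
    by simp_all
  have p_iff: "(\<sigma> ^^ k) x = p \<longleftrightarrow> k = 2 * n + 2" for k
    unfolding p by (rule iterate_index_inject[OF x(2)])
  \<comment> \<open>The integrand at \<open>r\<close> samples the variation only at
    \<open>\<sigma> r\<close> and \<open>\<sigma>inv r\<close>. At odd iterates these are the
    neighbouring even iterates, so the series of \<open>w\<close> is unaffected and that of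
    \<open>x\<close> changes only at the indices \<open>n\<close> and \<open>Suc n\<close>.\<close>
  have vanish: "g r e = g r 0" if "\<sigma> r \<noteq> p" "\<sigma>inv r \<noteq> p" for r e
    using that single_point_hahn_deriv_eq_0[OF pne that] by (simp add: g_def varied_def)
  have g_w: "g ((\<sigma> ^^ (2 * m + 1)) w) e = g ((\<sigma> ^^ (2 * m + 1)) w) 0" for m e
    using disjoint[of "Suc m"] disjoint[of m]
    by (intro vanish) (simp_all only: at_iterate p, simp_all)
  have g_x: "g ((\<sigma> ^^ (2 * m + 1)) x) e = g ((\<sigma> ^^ (2 * m + 1)) x) 0"
    if "m \<noteq> n" "m \<noteq> Suc n" for m e
  proof (rule vanish)
    show "\<sigma> ((\<sigma> ^^ (2 * m + 1)) x) \<noteq> p" "\<sigma>inv ((\<sigma> ^^ (2 * m + 1)) x) \<noteq> p"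
      unfolding at_iterate p_iff using that by simp_all
  qed

  \<comment> \<open>The point \<open>p\<close> lies between \<open>t\<close> and \<open>t'\<close>
    in the orbit: it is \<open>\<sigma> t\<close> and also \<open>\<sigma>inv t'\<close>. It enters
    the two quotients with opposite signs.\<close>
  have eta_t: "indicator {p} (\<sigma> t) = (1 :: real)" "D (indicator {p}) t = 1 / d"
    using tne p_iff[of "2 * n + 2"] p_iff[of "2 * n"]
    by (simp_all add: hahn_deriv_off_fp d_def t at_iterate)
  have "\<sigma> t' \<noteq> p" "\<sigma>inv t' = p"
    unfolding t'_def at_iterate p_iff by simp_all
  then have eta_t': "indicator {p} (\<sigma> t') = (0 :: real)" "D (indicator {p}) t' = - 1 / (q\<^sup>2 * d)"
    using tne d' by (simp_all add: hahn_deriv_off_fp)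

  have ind: "(indicator {p} :: real \<Rightarrow> real) differentiable (at fp within I)"
    using single_point_derivative[OF pne] real_differentiable_def by blast
  have along_eq: "along I q \<omega> L (\<lambda>t. y t + e * indicator {p} t) = (\<lambda>t. g t e)" for e
    unfolding g_def using along_add_scaled[OF y ind] by blast
  have along_eq0: "along I q \<omega> L y = (\<lambda>t. g t 0)"
    using along_eq[of 0] by simp

  \<comment> \<open>\<open>K\<close> combines the sign with the prefactor of the integral; \<phi> is
    the part of the signed functional that depends on \<open>e\<close>.\<close>
  define K where "K = s * (\<sigma>inv x - \<sigma> x)"
  have K: "K \<noteq> 0" using s shift_diff_eq_0_iff[of x] x by (auto simp: K_def)
  define \<phi> where "\<phi> e = K * (q ^ (2 * n + 1) * g t e + q ^ (2 * Suc n + 1) * g t' e)" for e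

  have g_deriv: "((\<lambda>e. g r e) has_real_derivative
      along I q \<omega> (partial2 L) y r * indicator {p} (\<sigma> r)
      + along I q \<omega> (partial3 L) y r * D (indicator {p}) r) (at 0)" if "r \<in> I" for r
    unfolding g_def varied_def along_def partial2_def partial3_def
    by (rule C1_line_derivative[OF C1[OF that]])
  define M where "M = along I q \<omega> (partial2 L) y"
  define P where "P = along I q \<omega> (partial3 L) y"
  have phi_deriv: "(\<phi> has_real_derivative
      K * (q ^ (2 * n + 1) * (M t * 1 + P t * (1 / d))
         + q ^ (2 * Suc n + 1) * (M t' * 0 + P t' * (- 1 / (q\<^sup>2 * d))))) (at 0)"
    unfolding \<phi>_def
    using g_deriv[OF tI(1)] g_deriv[OF tI(2)]
    by (intro DERIV_cmult DERIV_add) (simp_all only: eta_t eta_t' M_def P_def)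

  have "\<forall>\<^sub>F e in nhds 0. \<phi> 0 \<le> \<phi> e"
    using extremal integrable[of x, simplified]
  proof eventually_elim
    case (elim e)
    \<comment> \<open>A property holding eventually in \<open>nhds 0\<close> holds at 0 itself. Both
      series must converge before they are subtracted termwise.\<close>
    have int_x0: "hahn_integrable_to q \<omega> x (\<lambda>t. g t 0)"
      using eventually_nhds_x_imp_x[OF integrable[of x]] by (simp add: g_def)
    have w: "hahn_integral_to q \<omega> w (\<lambda>t. g t e) = hahn_integral_to q \<omega> w (\<lambda>t. g t 0)"
      unfolding hahn_integral_to_def by (simp only: g_w[of _ e])
    have x: "hahn_integral_to q \<omega> x (\<lambda>t. g t e) - hahn_integral_to q \<omega> x (\<lambda>t. g t 0)
        = (\<sigma>inv x - \<sigma> x) * ((q ^ (2 * n + 1) * g t e - q ^ (2 * n + 1) * g t 0)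
            + (q ^ (2 * Suc n + 1) * g t' e - q ^ (2 * Suc n + 1) * g t' 0))"
      unfolding hahn_integral_to_def t t'_def right_diff_distrib[symmetric]
      by (subst suminf_diff_two_terms[where n = n,
            OF elim(2)[folded g_def, unfolded hahn_integrable_to_def]
              int_x0[unfolded hahn_integrable_to_def]])
        (simp_all only: g_x[of _ e] right_diff_distrib not_False_eq_True)
    have "s * (hahn_integral_to q \<omega> x (\<lambda>t. g t e) - hahn_integral_to q \<omega> x (\<lambda>t. g t 0))
        = \<phi> e - \<phi> 0"
      unfolding x \<phi>_def K_def by (simp add: algebra_simps)
    moreover have "0 \<le> s * (hahn_integral_to q \<omega> x (\<lambda>t. g t e) - hahn_integral_to q \<omega> x (\<lambda>t. g t 0))"
      using elim(1) unfolding along_eq[of e] along_eq0 w by (simp add: right_diff_distrib)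
    ultimately show ?case by simp
  qed
  \<comment> \<open>By Fermat's rule the derivative of \<phi> vanishes at its local minimum
    0.\<close>
  then obtain \<rho> where "\<rho> > 0" "\<And>e. \<bar>e\<bar> < \<rho> \<Longrightarrow> \<phi> 0 \<le> \<phi> e"
    unfolding eventually_nhds_metric dist_real_def by auto
  then have "K * (q ^ (2 * n + 1) * (M t * 1 + P t * (1 / d))
         + q ^ (2 * Suc n + 1) * (M t' * 0 + P t' * (- 1 / (q\<^sup>2 * d)))) = 0"
    using DERIV_local_min[OF phi_deriv, of \<rho>] by simp
  moreover have "q ^ (2 * Suc n + 1) * (M t' * 0 + P t' * (- 1 / (q\<^sup>2 * d)))
      = q ^ (2 * n + 1) * (- P t' / d)"
    using q_pos by (simp add: power2_eq_square)
  ultimately have "K * (q ^ (2 * n + 1) * (M t + P t / d - P t' / d)) = 0"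
    by (simp only:) (simp add: right_diff_distrib distrib_left)
  then have "M t + P t / d - P t' / d = 0"
    using K q_pos by simp
  then have "M t = (P t' - P t) / d"
    using q_pos by (simp add: diff_divide_distrib)
  \<comment> \<open>Since \<open>t' = \<sigma> (\<sigma> t)\<close> and
    \<open>t = \<sigma> (\<sigma>inv t)\<close>, the right side is the Hahn quotient of
    \<open>P\<close> composed with the shift.\<close>
  then show ?thesis
    using tne by (simp add: M_def P_def t't d_def hahn_deriv_off_fp)
qed

text \<open>Both sides are limits along the odd iterates of \<open>x\<close>: the left by continuity
  of \<open>M\<close>, the right by \<open>hahn_deriv_iterate_tendsto\<close>. The latter applies
  because the shift fixes \<open>fp\<close> and maps \<open>I\<close> into itself, so the chain rule
  makes the composition differentiable there.\<close>

lemma euler_lagrange_fp: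
  assumes x: "x \<in> I" "x \<noteq> fp"
    and M: "continuous (at fp within I) M"
    and P: "P differentiable (at fp within I)"
    and eq: "\<And>n. M ((\<sigma> ^^ (2 * n + 1)) x) = D (\<lambda>\<tau>. P (\<sigma> \<tau>)) ((\<sigma> ^^ (2 * n + 1)) x)"
  shows "M fp = D (\<lambda>\<tau>. P (\<sigma> \<tau>)) fp"
proof -
  have "\<sigma> ` I \<subseteq> I"
    using iterate_in[of _ 1] by auto
  then have "P differentiable (at (\<sigma> fp) within \<sigma> ` I)"
    using P differentiable_within_subset by (simp only: shift_fp) blast
  moreover have "\<sigma> differentiable (at fp within I)"
    unfolding hahn_shift_def[abs_def] by (intro derivative_intros)
  ultimately have "(\<lambda>\<tau>. P (\<sigma> \<tau>)) differentiable (at fp within I)"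
    using differentiable_chain_within[of \<sigma> fp I P] by (simp add: o_def)
  from hahn_deriv_iterate_tendsto[OF this x]
  have "(\<lambda>n. M ((\<sigma> ^^ (2 * n + 1)) x)) \<longlonglongrightarrow> D (\<lambda>\<tau>. P (\<sigma> \<tau>)) fp"
    by (simp only: eq)
  moreover have "filterlim (\<lambda>k. (\<sigma> ^^ k) x) (at fp within I) sequentially"
    using iterate_tendsto iterate_in x by (simp add: filterlim_at)
  then have "(\<lambda>k. M ((\<sigma> ^^ k) x)) \<longlonglongrightarrow> M fp"
    using M unfolding continuous_within by (rule filterlim_compose[rotated])
  from LIMSEQ_subseq_LIMSEQ[OF this, of "\<lambda>n. 2 * n + 1"]
  have "(\<lambda>n. M ((\<sigma> ^^ (2 * n + 1)) x)) \<longlonglongrightarrow> M fp"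
    by (simp add: strict_mono_def o_def)
  ultimately show ?thesis
    using LIMSEQ_unique by blast
qed

end

section \<open>The equation on the whole set\<close>

theorem theorem7p3p8:
  fixes q \<omega> a b \<alpha> \<beta> :: real
    and I :: "real set"
    and L :: "real \<Rightarrow> real \<Rightarrow> real \<Rightarrow> real"
    and y_star :: "real \<Rightarrow> real"
  assumes q: "0 < q" "q < 1"
    and omega: "0 \<le> \<omega>"
    and I: "is_interval I" "hahn_fixpoint q \<omega> \<in> I"
    and ab: "a \<in> I" "b \<in> I" "a < b"
    and indep: "endpoints_independent q \<omega> a b"
    and i: "\<forall>t\<in>I. C1 (\<lambda>(u, v). L t u v)"
    and ii: "\<forall>y\<in>admissible I q \<omega> a b \<alpha> \<beta>.
               continuous (at (hahn_fixpoint q \<omega>) within hahn_shift q \<omega> ` I) (along I q \<omega> L y)"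
    and iii: "\<forall>y\<in>admissible I q \<omega> a b \<alpha> \<beta>.
               along I q \<omega> (partial2 L) y \<in> Y1 I q \<omega> a b \<and>
               along I q \<omega> (partial3 L) y \<in> Y1 I q \<omega> a b"
    and iv: "\<forall>y\<in>admissible I q \<omega> a b \<alpha> \<beta>. \<forall>\<eta>\<in>admissible_variation I q \<omega> a b.
               uniformly_differentiable_at (varied I q \<omega> L y \<eta>) 0 (hahn_set q \<omega> a b) \<and>
               (\<forall>\<xi>\<in>{a, b}.
                  (\<forall>\<^sub>F \<epsilon> in nhds 0. hahn_integrable_to q \<omega> \<xi> (\<lambda>t. varied I q \<omega> L y \<eta> t \<epsilon>)) \<and>
                  hahn_integrable_to q \<omega> \<xi> (\<lambda>t. deriv (varied I q \<omega> L y \<eta> t) 0))"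
    and extremizer: "local_minimizer I q \<omega> a b \<alpha> \<beta> L y_star \<or>
                     local_maximizer I q \<omega> a b \<alpha> \<beta> L y_star"
  shows "\<forall>t\<in>hahn_set q \<omega> a b.
           partial2 L t (y_star (hahn_shift q \<omega> t)) (hahn_deriv I q \<omega> y_star t) =
           hahn_deriv I q \<omega>
             (\<lambda>\<tau>. partial3 L (hahn_shift q \<omega> \<tau>)
                    (y_star ((hahn_shift q \<omega> ^^ 2) \<tau>))
                    (hahn_deriv I q \<omega> y_star (hahn_shift q \<omega> \<tau>))) t"
proof -
  \<comment> \<open>A connected set containing the two distinct points \<open>a\<close> and
    \<open>b\<close> has no isolated points.\<close>
  have "hahn_fixpoint q \<omega> islimpt I"
    using connected_imp_perfect[of I "hahn_fixpoint q \<omega>"] I ab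
    by (metis is_interval_connected less_irrefl singletonD)
  then interpret hahn_calculus I q \<omega>
    using q I by unfold_locales
  define M where "M = along I q \<omega> (partial2 L) y_star"
  define P where "P = along I q \<omega> (partial3 L) y_star"
  have ys: "y_star \<in> admissible I q \<omega> a b \<alpha> \<beta>"
    using extremizer by (auto simp: local_minimizer_def local_maximizer_def)
  then have ysY: "y_star \<in> Y1 I q \<omega> a b"
    by (simp add: admissible_def)
  have MP: "continuous (at fp within I) M" "P differentiable (at fp within I)"
    using iii ys by (auto simp: M_def P_def Y1_def)

  \<comment> \<open>Multiplication by \<open>c = -1\<close> turns a maximum into a minimum.\<close>
  have extremal: "\<exists>c\<in>{1, -1 :: real}. \<forall>\<eta>\<in>admissible_variation I q \<omega> a b. \<forall>\<^sub>F e in nhds 0.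
      c * hahn_functional I q \<omega> a b L y_star
      \<le> c * hahn_functional I q \<omega> a b L (\<lambda>t. y_star t + e * \<eta> t)"
  proof -
    obtain c \<delta> :: real where c: "c \<in> {1, -1}" and \<delta>: "\<delta> > 0" and
      min: "\<And>y. y \<in> admissible I q \<omega> a b \<alpha> \<beta> \<Longrightarrow> Y1_norm I q \<omega> a b (\<lambda>t. y_star t - y t) < \<delta> \<Longrightarrow>
          c * hahn_functional I q \<omega> a b L y_star \<le> c * hahn_functional I q \<omega> a b L y"
    proof (cases "local_minimizer I q \<omega> a b \<alpha> \<beta> L y_star")
      case True
      then show ?thesis
        using that[of 1] unfolding local_minimizer_def by auto
    next
      case False
      then have "local_maximizer I q \<omega> a b \<alpha> \<beta> L y_star" using extremizer by blast
      then show ?thesis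
        using that[of "-1"] unfolding local_maximizer_def by auto
    qed
    have "\<forall>\<^sub>F e in nhds 0. c * hahn_functional I q \<omega> a b L y_star
        \<le> c * hahn_functional I q \<omega> a b L (\<lambda>t. y_star t + e * \<eta> t)"
      if \<eta>: "\<eta> \<in> admissible_variation I q \<omega> a b" for \<eta>
    proof -
      have \<eta>Y: "\<eta> \<in> Y1 I q \<omega> a b"
        using \<eta> by (simp add: admissible_variation_def)
      obtain d where d: "d > 0"
        "\<And>e. \<bar>e\<bar> < d \<Longrightarrow> Y1_norm I q \<omega> a b (\<lambda>t. y_star t - (y_star t + e * \<eta> t)) < \<delta>"
        using Y1_norm_scaled_small[OF \<eta>Y \<delta>] by blast
      have "(\<lambda>t. y_star t + e * \<eta> t) \<in> admissible I q \<omega> a b \<alpha> \<beta>" for e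
        using Y1_add_scaled[OF ysY \<eta>Y] ys \<eta> by (simp add: admissible_def admissible_variation_def)
      then show ?thesis
        using d min unfolding eventually_nhds_metric dist_real_def by auto
    qed
    then show ?thesis using c by blast
  qed

  have iterates: "M ((\<sigma> ^^ (2 * n + 1)) x) = D (\<lambda>\<tau>. P (\<sigma> \<tau>)) ((\<sigma> ^^ (2 * n + 1)) x)"
    if xw: "(x, w) \<in> {(a, b), (b, a)}" and x: "x \<noteq> fp" for x w n
  proof -
    define p where "p = (\<sigma> ^^ (2 * n + 2)) x"
    have xI: "x \<in> I" using xw ab by auto
    \<comment> \<open>Cancelling common shifts from an equality would make one endpoint the
      \<open>2 * l\<close>-th iterate of the other. Independence excludes \<open>l \<ge> 1\<close>,
      and distinctness of the endpoints excludes \<open>l = 0\<close>.\<close>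
    have disjoint: "(\<sigma> ^^ (2 * m)) w \<noteq> (\<sigma> ^^ (2 * n + 2)) x" for m
    proof
      assume eq: "(\<sigma> ^^ (2 * m)) w = (\<sigma> ^^ (2 * n + 2)) x"
      have ne: "x \<noteq> w" using xw ab by auto
      have indep': "k \<ge> 1 \<Longrightarrow> (\<sigma> ^^ (2 * k)) x \<noteq> w \<and> (\<sigma> ^^ (2 * k)) w \<noteq> x" for k
        using indep xw unfolding endpoints_independent_def by auto
      show False
      proof (cases m "n + 1" rule: le_cases)
        case le
        then obtain l where "n + 1 = m + l" using le_Suc_ex by blast
        then have l: "2 * n + 2 = 2 * m + 2 * l" by simp
        then have "(\<sigma> ^^ (2 * l)) x = w"
          using eq unfolding l by (simp add: funpow_add)
        then show False
          using indep'[of l] ne by (cases "l = 0") auto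
      next
        case ge
        then obtain l where "m = n + 1 + l" using le_Suc_ex by blast
        then have l: "2 * m = (2 * n + 2) + 2 * l" by simp
        then have "(\<sigma> ^^ (2 * l)) w = x"
          using eq unfolding l funpow_add o_apply by (simp only: iterate_inject)
        then show False
          using indep'[of l] ne by (cases "l = 0") auto
      qed
    qed
    \<comment> \<open>The variation must vanish at both endpoints, so \<open>p\<close> has to differ
      from each.\<close>
    have "p \<noteq> x"
      using iterate_index_inject[OF x, of "2 * n + 2" 0] unfolding p_def by simp
    moreover have "p \<noteq> w"
      using disjoint[of 0] by (simp add: p_def)
    moreover have pne: "p \<noteq> fp"
      using x iterate_eq_fp_iff unfolding p_def by blast
    ultimately have var: "indicator {p} \<in> admissible_variation I q \<omega> a b"
      using xw single_point_in_Y1 by (auto simp: admissible_variation_def)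
    obtain c :: real where c: "c \<in> {1, -1}" and ev: "\<forall>\<^sub>F e in nhds 0.
      c * hahn_functional I q \<omega> a b L y_star
      \<le> c * hahn_functional I q \<omega> a b L (\<lambda>t. y_star t + e * indicator {p} t)"
      using extremal var by blast
    \<comment> \<open>The integral is the part from \<open>b\<close> minus the part from
      \<open>a\<close>, so putting the part of \<open>x\<close> first flips the sign when
      \<open>x = a\<close>.\<close>
    define s where "s = (if x = b then c else - c)"
    have s: "s \<noteq> 0" using c by (auto simp: s_def)
    have functional: "c * hahn_functional I q \<omega> a b L y =
        s * (hahn_integral_to q \<omega> x (along I q \<omega> L y) - hahn_integral_to q \<omega> w (along I q \<omega> L y))" for y
      using xw ab by (auto simp: s_def hahn_functional_def hahn_integral_def algebra_simps)
    have integrable: "\<forall>\<^sub>F e in nhds 0.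
        hahn_integrable_to q \<omega> \<xi> (\<lambda>t. varied I q \<omega> L y_star (indicator {p}) t e)"
      if "\<xi> \<in> {x, w}" for \<xi>
      using iv ys var xw that by fastforce
    show ?thesis
      unfolding M_def P_def
      by (rule euler_lagrange_iterate[where n = n, OF xI x disjoint _ _ p_def integrable s
            ev[unfolded functional] refl])
        (use i ysY in \<open>auto simp: Y1_def\<close>)
  qed

  \<comment> \<open>As \<open>a < b\<close>, at least one endpoint differs from the fixed point and
    supplies a sequence of iterates approaching it.\<close>
  have at_fp: "M fp = D (\<lambda>\<tau>. P (\<sigma> \<tau>)) fp"
  proof (cases "a = fp")
    case True
    then have "b \<noteq> fp" using ab by simp
    then show ?thesis
      using euler_lagrange_fp[OF ab(2) _ MP] iterates[of b a] by blast
  next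
    case False
    then show ?thesis
      using euler_lagrange_fp[OF ab(1) _ MP] iterates[of a b] by blast
  qed
  have "M t = D (\<lambda>\<tau>. P (\<sigma> \<tau>)) t" if "t \<in> hahn_set q \<omega> a b" for t
  proof (cases "t = fp")
    case True
    then show ?thesis using at_fp by simp
  next
    case False
    then have "(\<exists>n. t = (\<sigma> ^^ (2 * n + 1)) a) \<or> (\<exists>n. t = (\<sigma> ^^ (2 * n + 1)) b)"
      using that by (simp only: hahn_set_def Un_iff mem_Collect_eq singleton_iff simp_thms)
    then obtain x n where x: "x \<in> {a, b}" "t = (\<sigma> ^^ (2 * n + 1)) x"
      by blast
    then have "x \<noteq> fp"
      using False iterate_fp[of "2 * n + 1"] by auto
    moreover obtain w where "(x, w) \<in> {(a, b), (b, a)}"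
      using x(1) by blast
    ultimately show ?thesis
      unfolding x(2) by (intro iterates)
  qed
  then show ?thesis
    by (simp add: M_def P_def along_def numeral_2_eq_2)
qed

end
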